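(* Let $q\geq 1$ and $0\leq r<s$ be fixed integers, let $x$ be a variable (or a complex number), and for $k\ge 0$ set $$e_k^{\pm}:=E_k\!\left(\tfrac{x+r}{q}\right)\pm E_k\!\left(\tfrac{x+s}{q}\right).$$ Then for all integers $m\geq 0$ we have $H_{2m}(e_k^{-})=0$ and $$H_{2m+1}(e_k^{-})=(-1)^{m+1}\left(\frac{s-r}{q}\right)^{2m+2}\prod_{\ell=1}^m\left(\frac{\ell^2}{4}\left(\left(\frac{s-r}{q}\right)^2-(2\ell)^2\right)\right)^{2(m+1-\ell)}.$$ Furthermore, $$H_{2m}(e_k^{+})=(-1)^{m}\frac{2^{2m+1}}{m!^2}\prod_{\ell=1}^m\left(\frac{\ell^2}{4}\left(\left(\frac{s-r}{q}\right)^2-(2\ell-1)^2\right)\right)^{2(m+1-\ell)}$$ and $$H_{2m+1}(e_k^{+})=\prod_{\ell=0}^m\frac{\ell!^4}{16^\ell}\left(\left(\frac{s-r}{q}\right)^2-(2\ell+1)^2\right)^{2(m-\ell)+1}.$$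
   Context: The Euler polynomials $E_k(x)$ are defined by $\frac{2e^{xt}}{e^t+1}=\sum_{k\ge 0}E_k(x)\frac{t^k}{k!}$. For a sequence $(c_0,c_1,\ldots)$ (indexed from $k=0$), $H_n(c_k)=\det\big(c_{i+j}\big)_{0\le i,j\le n}$. Here $m!^2=(m!)^2$, $\ell!^4=(\ell!)^4$, and empty products equal $1$. *)

theory Defs
  imports
    "HOL-Computational_Algebra.Formal_Power_Series"
    "HOL-Computational_Algebra.Polynomial"
    "Jordan_Normal_Form.Determinant"
begin

text \<open>
  The value at \<open>x\<close> of the \<open>k\<close>-th Euler polynomial, read off from the exponential
  generating function \<open>2 e\<^sup>x\<^sup>t / (e\<^sup>t + 1)\<close>. The quotient is taken in the ring of formal
  power series in \<open>t\<close>; it is a genuine quotient because the denominator has constant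
  term \<open>2\<close>, see \<open>euler_poly_generating_function\<close>.
\<close>

definition euler_poly :: "nat \<Rightarrow> 'a :: field_char_0 \<Rightarrow> 'a" where
  "euler_poly k x = fact k * fps_nth (2 * fps_exp x / (fps_exp 1 + 1)) k"

text \<open>The index \<open>n\<close> is the largest row index, so the matrix has size \<open>n + 1\<close>.\<close>

definition hankel_det :: "(nat \<Rightarrow> 'a :: comm_ring_1) \<Rightarrow> nat \<Rightarrow> 'a" where
  "hankel_det c n = det (mat (n + 1) (n + 1) (\<lambda>(i, j). c (i + j)))"

lemma euler_poly_generating_function:
  fixes x :: "'a :: field_char_0"
  shows "Abs_fps (\<lambda>k. euler_poly k x / fact k) * (fps_exp 1 + 1) = 2 * fps_exp x"
proof -
  have unit: "fps_nth (fps_exp (1::'a) + 1) 0 \<noteq> 0"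
    by simp
  have "Abs_fps (\<lambda>k. euler_poly k x / fact k) = 2 * fps_exp x / (fps_exp 1 + 1)"
    by (rule fps_ext) (simp add: euler_poly_def)
  also have "\<dots> = 2 * fps_exp x * inverse (fps_exp 1 + 1)"
    using unit by (rule fps_divide_unit)
  finally show ?thesis
    using inverse_mult_eq_1[OF unit] by (simp add: mult.assoc)
qed

text \<open>\<open>euler_poly k\<close> is a polynomial function, with coefficients independent of \<open>x\<close>.\<close>

lemma euler_poly_is_polynomial:
  "\<exists>p :: 'a :: field_char_0 poly. \<forall>x. euler_poly k x = poly p x"
proof -
  define a :: "nat \<Rightarrow> 'a" where "a = fps_nth (2 * inverse (fps_exp 1 + 1))"
  have unit: "fps_nth (fps_exp (1::'a) + 1) 0 \<noteq> 0"
    by simp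
  have "euler_poly k x = poly (\<Sum>i\<le>k. monom (fact k * a (k - i) / fact i) i) x" for x :: 'a
  proof -
    have "2 * fps_exp x / (fps_exp 1 + 1) = fps_exp x * (2 * inverse (fps_exp 1 + 1))"
      using fps_divide_unit[OF unit] by (simp add: mult_ac)
    then have "euler_poly k x = fact k * (\<Sum>i=0..k. (x ^ i / fact i) * a (k - i))"
      by (simp add: euler_poly_def a_def fps_mult_nth)
    then show ?thesis
      by (simp add: poly_sum poly_monom sum_distrib_left atMost_atLeast0 mult_ac)
  qed
  then show ?thesis by blast
qed

end

theory Submission
  imports Defs
begin

text \<open>
  With \<open>A = (x + r)/q\<close>, \<open>B = (x + s)/q\<close> and \<open>\<delta> = d/2 = (B - A)/2\<close>, let \<open>M\<close> be the functional on polynomials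
  in \<open>X\<close> whose moments are \<open>e\<^sub>k\<close>, with \<open>X\<close> recentred at \<open>(A + B - 1)/2\<close>. The generating function of
  the Euler polynomials gives \<open>M(p(X + 1/2) + p(X - 1/2)) = 2 (p(-\<delta>) \<plusminus> p(\<delta>))\<close>. Put \<open>a = 1/2 + \<delta>\<close> and
  \<open>b = 1/2 - \<delta>\<close>. Taking \<open>p = (\<delta> + X)\<^sub>n (\<delta> - X)\<^sub>n\<close>, which vanishes at \<open>\<plusminus>\<delta>\<close>, yields a recurrence for
  \<open>M\<close> on \<open>u\<^sub>n = (a + X)\<^sub>n (a - X)\<^sub>n\<close>, and from it \<open>M(u\<^sub>n v\<^sub>k) = M(1) (n + k)! (a)\<^sub>n (b)\<^sub>k\<close> for
  \<open>v\<^sub>k = (b + X)\<^sub>k (b - X)\<^sub>k\<close>, with similar formulas after inserting \<open>X\<close> or \<open>X\<^sup>2\<close>. Thus in the bases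
  \<open>u\<^sub>n, X u\<^sub>n\<close> and \<open>v\<^sub>k, X v\<^sub>k\<close> the Hankel form is, up to row and column factors, made of the matrices
  \<open>(n + k)!\<close>, which the Vandermonde identity factors into triangular ones.
\<close>

section \<open>Determinants: triangular factorisations, factorial matrices and matrices of 2 x 2
  blocks\<close>

lemma det_lower_triangular_prod:
  fixes A :: "'a :: comm_ring_1 mat"
  assumes "A \<in> carrier_mat n n" and "\<And>i j. i < j \<Longrightarrow> j < n \<Longrightarrow> A $$ (i, j) = 0"
  shows "det A = (\<Prod>i<n. A $$ (i, i))"
  using det_lower_triangular[OF assms(2,1)] assms(1)
  by (simp add: prod_list_diag_prod atLeast0LessThan)

lemma det_upper_triangular_prod:
  fixes A :: "'a :: comm_ring_1 mat"
  assumes "A \<in> carrier_mat n n" and "\<And>i j. j < i \<Longrightarrow> i < n \<Longrightarrow> A $$ (i, j) = 0"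
  shows "det A = (\<Prod>i<n. A $$ (i, i))"
proof -
  have "upper_triangular A"
    using assms by (auto simp: upper_triangular_def)
  then show ?thesis
    using det_upper_triangular assms(1) by (auto simp: prod_list_diag_prod atLeast0LessThan)
qed

text \<open>The entries are those of F * (H * G) with F lower and G upper triangular. This serves
  twice: to factor the matrices of factorials, and to change polynomial bases in a Hankel
  form.\<close>

lemma det_triple_product:
  fixes f g h :: "nat \<Rightarrow> nat \<Rightarrow> 'a :: comm_ring_1"
  assumes f: "\<And>i k. i < k \<Longrightarrow> k < n \<Longrightarrow> f i k = 0"
    and g: "\<And>l j. j < l \<Longrightarrow> l < n \<Longrightarrow> g l j = 0"
  shows "det (mat n n (\<lambda>(i, j). \<Sum>k<n. f i k * (\<Sum>l<n. h k l * g l j)))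
    = (\<Prod>i<n. f i i * g i i) * det (mat n n (\<lambda>(i, j). h i j))"
proof -
  let ?F = "mat n n (\<lambda>(i, j). f i j)" and ?G = "mat n n (\<lambda>(i, j). g i j)"
    and ?H = "mat n n (\<lambda>(i, j). h i j)"
  have "mat n n (\<lambda>(i, j). \<Sum>k<n. f i k * (\<Sum>l<n. h k l * g l j)) = ?F * (?H * ?G)"
    by (rule eq_matI) (simp_all add: scalar_prod_def atLeast0LessThan)
  then have "det (mat n n (\<lambda>(i, j). \<Sum>k<n. f i k * (\<Sum>l<n. h k l * g l j)))
    = det ?F * (det ?H * det ?G)"
    by (simp add: det_mult[of _ n] mult_carrier_mat[of _ n n _ n])
  also have "det ?F = (\<Prod>i<n. f i i)"
    using f by (subst det_lower_triangular_prod[of _ n]) simp_all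
  also have "det ?G = (\<Prod>i<n. g i i)"
    using g by (subst det_upper_triangular_prod[of _ n]) simp_all
  finally show ?thesis
    by (simp add: prod.distrib mult_ac)
qed

text \<open>Vandermonde after replacing \<open>n choose h\<close> by
  \<open>n choose (n - h)\<close>. Read as a matrix product over \<open>h\<close>, it is a lower
  times upper unitriangular factorisation of the matrix of \<open>(n + k) choose n\<close>.\<close>

lemma sum_choose_choose: "(\<Sum>h\<le>n. (n choose h) * (k choose h)) = (n + k) choose n"
proof -
  have "(\<Sum>h\<le>n. (n choose h) * (k choose h)) = (\<Sum>h\<le>n. (k choose h) * (n choose (n - h)))"
    by (rule sum.cong) (simp_all add: binomial_symmetric[symmetric] mult.commute)
  then show ?thesis
    by (simp add: vandermonde add.commute)
qed

lemma div_2_less: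
  fixes i k :: nat
  assumes "k mod 2 = i mod 2" and "i < k"
  shows "i div 2 < k div 2"
  using assms by presburger

text \<open>Substitute \<open>k = 2 * h + i mod 2\<close>. The terms up to
  \<open>h = i div 2\<close> all have \<open>k \<le> i < N\<close>, so the cut at \<open>N\<close>
  loses only terms where \<open>F\<close> is zero.\<close>

lemma sum_same_parity:
  fixes F :: "nat \<Rightarrow> 'a :: comm_monoid_add"
  assumes "i < N" and "\<And>h. i div 2 < h \<Longrightarrow> F h = 0"
  shows "(\<Sum>k<N. if k mod 2 = i mod 2 then F (k div 2) else 0) = (\<Sum>h\<le>i div 2. F h)"
proof -
  have "(\<Sum>k<N. if k mod 2 = i mod 2 then F (k div 2) else 0)
    = (\<Sum>k\<in>(\<lambda>h. 2 * h + i mod 2) ` {..i div 2}. F (k div 2))"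
  proof (intro sum.mono_neutral_cong_right ballI)
    show "(\<lambda>h. 2 * h + i mod 2) ` {..i div 2} \<subseteq> {..<N}"
    proof
      fix k :: nat assume "k \<in> (\<lambda>h. 2 * h + i mod 2) ` {..i div 2}"
      then obtain h where "h \<le> i div 2" "k = 2 * h + i mod 2"
        by auto
      then have "k \<le> i"
        using mult_div_mod_eq[of 2 i] by linarith
      also have "i < N"
        by (fact assms(1))
      finally show "k \<in> {..<N}"
        by simp
    qed
  next
    fix k assume k: "k \<in> {..<N} - (\<lambda>h. 2 * h + i mod 2) ` {..i div 2}"
    have "i div 2 < k div 2" if "k mod 2 = i mod 2"
    proof (rule ccontr)
      assume "\<not> i div 2 < k div 2"
      moreover have "k = 2 * (k div 2) + i mod 2"
        using that by presburger
      ultimately show False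
        using k by auto
    qed
    then show "(if k mod 2 = i mod 2 then F (k div 2) else 0) = 0"
      using assms(2) by simp
  qed auto
  also have "\<dots> = (\<Sum>h\<le>i div 2. F h)"
    by (subst sum.reindex) (auto simp: inj_on_def)
  finally show ?thesis .
qed

text \<open>View an index \<open>i\<close> as the pair of \<open>i div 2\<close> and
  \<open>i mod 2\<close>. Since (n + k)! = n! k! \<Sum>h. C(n,h) C(k,h), the matrix factors through
  triangular matrices \<open>F\<close> and \<open>G\<close> that preserve parity, with block
  diagonal middle factor \<open>h\<close> whose 2 x 2 blocks are \<kappa>. For odd \<open>N\<close>
  the last block is cut to size 1.\<close>

lemma det_factorial_blocks:
  fixes f g :: "nat \<Rightarrow> 'a :: field_char_0" and \<kappa> :: "nat \<Rightarrow> nat \<Rightarrow> 'a"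
  shows "det (mat N N (\<lambda>(i, j). f i * g j * fact (i div 2 + j div 2) * \<kappa> (i mod 2) (j mod 2)))
    = (\<Prod>i<N. f i * g i * (fact (i div 2))\<^sup>2)
      * det (mat N N (\<lambda>(i, j). if i div 2 = j div 2 then \<kappa> (i mod 2) (j mod 2) else 0))"
proof -
  define F where "F i k = (if k mod 2 = i mod 2
    then f i * fact (i div 2) * of_nat (i div 2 choose (k div 2)) else 0)" for i k
  define G where "G l j = (if l mod 2 = j mod 2
    then g j * fact (j div 2) * of_nat (j div 2 choose (l div 2)) else 0)" for l j
  define h where "h k l = (if k div 2 = l div 2 then \<kappa> (k mod 2) (l mod 2) else 0)" for k l
  have inner: "(\<Sum>l<N. h k l * G l j) = \<kappa> (k mod 2) (j mod 2) * g j * fact (j div 2)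
      * of_nat (j div 2 choose (k div 2))" if "k < N" "j < N" for k j
  proof -
    \<comment> \<open>The only index lying in the block of \<open>k\<close> and having the parity of
      \<open>j\<close>, so the only one that contributes to the sum.\<close>
    define l0 where "l0 = 2 * (k div 2) + j mod 2"
    have "(\<Sum>l<N. h k l * G l j) = (\<Sum>l<N. if l = l0 then h k l0 * G l0 j else 0)"
    proof (rule sum.cong)
      fix l
      show "h k l * G l j = (if l = l0 then h k l0 * G l0 j else 0)"
      proof (cases "l = l0")
        case False
        then have "\<not> (k div 2 = l div 2 \<and> l mod 2 = j mod 2)"
          unfolding l0_def by (metis mult_div_mod_eq)
        then show ?thesis
          using False by (auto simp: h_def G_def)
      qed simp
    qed simp
    also have "\<dots> = (if l0 < N then h k l0 * G l0 j else 0)"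
      by simp
    also have "\<dots> = \<kappa> (k mod 2) (j mod 2) * g j * fact (j div 2)
      * of_nat (j div 2 choose (k div 2))"
    proof (cases "l0 < N")
      case True
      then show ?thesis
        by (simp add: h_def G_def l0_def mult_ac)
    next
      \<comment> \<open>Here \<open>l0\<close> falls in the missing half of a truncated last block.
        Then \<open>j < l0\<close> forces \<open>j div 2 < k div 2\<close>, and the binomial
        coefficient is zero too.\<close>
      case False
      then have "j < 2 * (k div 2) + j mod 2"
        using that by (simp add: l0_def)
      then have "2 * (j div 2) < 2 * (k div 2)"
        using mult_div_mod_eq[of 2 j] by linarith
      then have "j div 2 < k div 2"
        by linarith
      then show ?thesis
        using False by simp
    qed
    finally show ?thesis .
  qed
  have entry: "f i * g j * fact (i div 2 + j div 2) * \<kappa> (i mod 2) (j mod 2)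
    = (\<Sum>k<N. F i k * (\<Sum>l<N. h k l * G l j))" if "i < N" "j < N" for i j
  proof -
    define c where "c = f i * fact (i div 2) * g j * fact (j div 2) * \<kappa> (i mod 2) (j mod 2)"
    have "(\<Sum>k<N. F i k * (\<Sum>l<N. h k l * G l j)) = (\<Sum>k<N. if k mod 2 = i mod 2
      then c * of_nat ((i div 2 choose (k div 2)) * (j div 2 choose (k div 2))) else 0)"
      using that by (intro sum.cong) (auto simp: inner F_def c_def)
    also have "\<dots> = (\<Sum>h\<le>i div 2. c * of_nat ((i div 2 choose h) * (j div 2 choose h)))"
      using that by (intro sum_same_parity) auto
    also have "\<dots> = c * of_nat ((i div 2 + j div 2) choose (i div 2))"
      by (simp only: sum_distrib_left[symmetric] of_nat_sum[symmetric] sum_choose_choose)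
    also have "\<dots> = f i * g j * fact (i div 2 + j div 2) * \<kappa> (i mod 2) (j mod 2)"
      by (simp add: c_def binomial_fact)
    finally show ?thesis ..
  qed
  have "mat N N (\<lambda>(i, j). f i * g j * fact (i div 2 + j div 2) * \<kappa> (i mod 2) (j mod 2))
    = mat N N (\<lambda>(i, j). \<Sum>k<N. F i k * (\<Sum>l<N. h k l * G l j))"
    by (rule eq_matI) (simp_all add: entry)
  also have "det \<dots> = (\<Prod>i<N. F i i * G i i) * det (mat N N (\<lambda>(i, j). h i j))"
    by (rule det_triple_product) (auto simp: F_def G_def dest: div_2_less)
  finally show ?thesis
    by (simp add: F_def G_def h_def power2_eq_square mult_ac)
qed

text \<open>The last index \<open>2 * n\<close> has no partner in its block, so its row is
  zero.\<close>

lemma det_swap_blocks_odd: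
  "det (mat (2 * n + 1) (2 * n + 1)
    (\<lambda>(i, j). if i div 2 = j div 2 \<and> i \<noteq> j then y else (0 :: 'a :: idom))) = 0"
  (is "det ?J = 0")
proof -
  have "?J = mat\<^sub>r (2 * n + 1) (2 * n + 1)
      (\<lambda>i. if i = 2 * n then 0\<^sub>v (2 * n + 1) else row ?J i)"
    by (rule eq_matI) auto
  also have "det \<dots> = 0"
    by (rule det_row_0) auto
  finally show ?thesis .
qed

text \<open>Induction splits off the last 2 x 2 block, which has zero diagonal and both other
  entries \<open>y\<close>.\<close>

lemma det_swap_blocks_even:
  "det (mat (2 * n) (2 * n)
    (\<lambda>(i, j). if i div 2 = j div 2 \<and> i \<noteq> j then y else (0 :: 'a :: idom))) = (- y\<^sup>2) ^ n"
proof (induction n)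
  case (Suc n)
  let ?J = "\<lambda>N. mat N N (\<lambda>(i, j). if i div 2 = j div 2 \<and> i \<noteq> j then y else (0 :: 'a))"
  have "?J (2 * Suc n) = four_block_mat (?J (2 * n)) (0\<^sub>m (2 * n) 2) (0\<^sub>m 2 (2 * n)) (?J 2)"
    (is "_ = ?B")
  proof (rule eq_matI)
    fix i j assume "i < dim_row ?B" "j < dim_col ?B"
    then have ij: "i < 2 * n + 2" "j < 2 * n + 2"
      by auto
    have lo: "k div 2 < n" if "k < 2 * n" for k
      using that by linarith
    have hi: "k div 2 = n" if "\<not> k < 2 * n" "k < 2 * n + 2" for k
      using that by linarith
    have eq: "i - 2 * n = j - 2 * n \<longleftrightarrow> i = j" if "\<not> i < 2 * n" "\<not> j < 2 * n"
      using that by linarith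
    have zero: "(k - 2 * n) div 2 = 0" if "k < 2 * n + 2" for k
      using that by linarith
    consider "i < 2 * n" "j < 2 * n" | "i < 2 * n" "\<not> j < 2 * n"
      | "\<not> i < 2 * n" "j < 2 * n" | "\<not> i < 2 * n" "\<not> j < 2 * n"
      by blast
    then show "?J (2 * Suc n) $$ (i, j) = ?B $$ (i, j)"
    proof cases
      case 1
      then show ?thesis
        using ij by simp
    next
      case 2
      then have "i div 2 \<noteq> j div 2"
        using lo[of i] hi[of j] ij by simp
      then show ?thesis
        using 2 ij by simp
    next
      case 3
      then have "i div 2 \<noteq> j div 2"
        using lo[of j] hi[of i] ij by simp
      then show ?thesis
        using 3 ij by simp
    next
      case 4
      then have "i - 2 * n < 2" "j - 2 * n < 2"
        using ij by linarith+
      then show ?thesis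
        using 4 ij eq[OF 4] hi[OF 4(1) ij(1)] hi[OF 4(2) ij(2)] zero[OF ij(1)] zero[OF ij(2)]
        by simp
    qed
  qed simp_all
  then have "det (?J (2 * Suc n)) = det (?J (2 * n)) * det (?J 2)"
    by (simp add: det_four_block_mat_upper_right_zero[of _ "2 * n" _ 2])
  also have "det (?J 2) = - y\<^sup>2"
  proof -
    have "?J 2 = swaprows 0 1 (y \<cdot>\<^sub>m 1\<^sub>m 2)"
      by (rule eq_matI) (auto simp: less_2_cases_iff)
    then show ?thesis
      by (simp add: det_swaprows[of _ 2] det_smult)
  qed
  finally show ?case
    using Suc.IH by simp
qed simp

section \<open>Moment functionals and Hankel determinants in arbitrary polynomial bases\<close>

definition umbral :: "(nat \<Rightarrow> 'a :: comm_ring_1) \<Rightarrow> 'a poly \<Rightarrow> 'a" where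
  "umbral c p = (\<Sum>k\<le>degree p. coeff p k * c k)"

lemma umbral_altdef:
  assumes "degree p \<le> n"
  shows "umbral c p = (\<Sum>k\<le>n. coeff p k * c k)"
  unfolding umbral_def using assms
  by (intro sum.mono_neutral_left) (auto simp: coeff_eq_0)

lemma umbral_add: "umbral c (p + q) = umbral c p + umbral c q"
  using degree_add_le_max[of p q]
  by (simp add: umbral_altdef[of _ "max (degree p) (degree q)"] sum.distrib algebra_simps)

lemma umbral_smult: "umbral c (smult a p) = a * umbral c p"
  by (simp add: umbral_altdef[of _ "degree p"] degree_smult_le sum_distrib_left mult_ac)

lemma umbral_0 [simp]: "umbral c 0 = 0"
  by (simp add: umbral_def)

lemma umbral_sum: "umbral c (\<Sum>i\<in>A. f i) = (\<Sum>i\<in>A. umbral c (f i))"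
  by (induction A rule: infinite_finite_induct) (simp_all add: umbral_add)

lemma umbral_monom: "umbral c (monom a n) = a * c n"
proof -
  have "umbral c (monom a n) = (\<Sum>k\<le>n. if k = n then a * c n else 0)"
    unfolding umbral_altdef[OF degree_monom_le] by (rule sum.cong) auto
  then show ?thesis
    by simp
qed

text \<open>The Hankel matrix is the Gram matrix of the form (p, q) \<mapsto>
  \<open>umbral c (p * q)\<close> in the monomials. The common bound \<open>N\<close> puts all
  coefficient vectors in one space.\<close>

lemma umbral_mult:
  assumes "degree p < N" and "degree q < N"
  shows "umbral c (p * q) = (\<Sum>k<N. coeff p k * (\<Sum>l<N. c (k + l) * coeff q l))"
proof -
  have monoms: "(\<Sum>k<N. monom (coeff r k) k) = r" if "degree r < N" for r :: "'a poly"
    using poly_as_sum_of_monoms'[of r "N - 1"] that by (cases N) (auto simp: lessThan_Suc_atMost)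
  have "p * q = (\<Sum>k<N. \<Sum>l<N. monom (coeff p k * coeff q l) (k + l))"
    by (subst (1 2) monoms[symmetric]) (simp_all add: assms sum_product mult_monom)
  then show ?thesis
    by (simp add: umbral_sum umbral_monom sum_distrib_left mult_ac)
qed

text \<open>Bases with one polynomial in each degree have triangular coefficient matrices, with the
  leading coefficients on the diagonal. Rows and columns may use different bases, as they will
  below.\<close>

lemma det_umbral_mult:
  assumes "\<And>i. i \<le> n \<Longrightarrow> degree (P i) = i" and "\<And>i. i \<le> n \<Longrightarrow> degree (Q i) = i"
  shows "det (mat (n + 1) (n + 1) (\<lambda>(i, j). umbral c (P i * Q j)))
    = (\<Prod>i<n + 1. lead_coeff (P i) * lead_coeff (Q i)) * hankel_det c n"
proof -
  have "mat (n + 1) (n + 1) (\<lambda>(i, j). umbral c (P i * Q j)) = mat (n + 1) (n + 1)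
      (\<lambda>(i, j). \<Sum>k<n + 1. coeff (P i) k * (\<Sum>l<n + 1. c (k + l) * coeff (Q j) l))"
    using assms by (intro eq_matI) (simp_all add: umbral_mult[of _ "n + 1"] del: sum.lessThan_Suc)
  also have "det \<dots> = (\<Prod>i<n + 1. coeff (P i) i * coeff (Q i) i) * hankel_det c n"
    unfolding hankel_det_def using assms
    by (intro det_triple_product) (simp_all add: coeff_eq_0)
  also have "(\<Prod>i<n + 1. coeff (P i) i * coeff (Q i) i)
      = (\<Prod>i<n + 1. lead_coeff (P i) * lead_coeff (Q i))"
    using assms by (intro prod.cong) simp_all
  finally show ?thesis .
qed

lemma pcompose_power: "pcompose (p ^ n) q = pcompose p q ^ n"
  by (induction n) (simp_all add: pcompose_1 pcompose_mult)

section \<open>The functional whose moments are Euler polynomials\<close>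

definition euler_functional :: "'a :: field_char_0 \<Rightarrow> 'a poly \<Rightarrow> 'a" where
  "euler_functional z = umbral (\<lambda>k. euler_poly k z)"

text \<open>Compare coefficients of t^n in the generating function multiplied by e^t + 1, then clear
  the factor 1/n!.\<close>

lemma sum_choose_euler_poly:
  fixes z :: "'a :: field_char_0"
  shows "(\<Sum>k\<le>n. of_nat (n choose k) * euler_poly k z) + euler_poly n z = 2 * z ^ n"
proof -
  define F where "F = Abs_fps (\<lambda>k. euler_poly k z / fact k)"
  have "F * (fps_exp 1 + 1) = 2 * fps_exp z"
    unfolding F_def by (rule euler_poly_generating_function)
  then have "F * fps_exp 1 + F = fps_const 2 * fps_exp z"
    by (simp only: distrib_left mult_1_right numeral_fps_const)
  then have "fps_nth (F * fps_exp 1) n + fps_nth F n = 2 * (z ^ n / fact n)"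
    by (metis fps_add_nth fps_mult_left_const_nth fps_exp_nth of_nat_fact)
  then have "(\<Sum>k\<le>n. euler_poly k z / fact k / fact (n - k)) + euler_poly n z / fact n
    = 2 * (z ^ n / fact n)"
    by (simp add: F_def fps_mult_nth atMost_atLeast0)
  then have "fact n * ((\<Sum>k\<le>n. euler_poly k z / fact k / fact (n - k)) + euler_poly n z / fact n)
    = fact n * (2 * (z ^ n / fact n))"
    by (rule arg_cong)
  moreover have "fact n * (\<Sum>k\<le>n. euler_poly k z / fact k / fact (n - k))
    = (\<Sum>k\<le>n. of_nat (n choose k) * euler_poly k z)"
    unfolding sum_distrib_left by (rule sum.cong) (simp_all add: binomial_fact)
  ultimately show ?thesis
    by (simp add: distrib_left)
qed

text \<open>The umbral form of \<open>E\<^sub>k(z + 1) + E\<^sub>k(z) = 2 z\<^sup>k\<close>.\<close>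

lemma euler_functional_shift:
  fixes z :: "'a :: field_char_0"
  shows "euler_functional z (pcompose p [:1, 1:]) + euler_functional z p = 2 * poly p z"
proof -
  have monom: "euler_functional z ([:1, 1:] ^ n) + euler_poly n z = 2 * z ^ n" for n
  proof -
    have "[:1, 1:] ^ n = (monom 1 1 + 1 :: 'a poly) ^ n"
      by (simp add: monom_altdef one_pCons)
    also have "\<dots> = (\<Sum>k\<le>n. monom (of_nat (n choose k)) k)"
      by (simp add: binomial_ring monom_power of_nat_poly monom_altdef)
    finally show ?thesis
      by (simp add: euler_functional_def umbral_sum umbral_monom sum_choose_euler_poly)
  qed
  \<comment> \<open>By linearity it is enough to treat monomials, so \<open>p\<close> is expanded
    and reassembled at the end.\<close>
  let ?s = "\<Sum>i\<le>degree p. monom (coeff p i) i"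
  have "euler_functional z (pcompose ?s [:1, 1:]) + euler_functional z ?s
    = (\<Sum>i\<le>degree p. coeff p i * (euler_functional z ([:1, 1:] ^ i) + euler_poly i z))"
    unfolding euler_functional_def pcompose_sum umbral_sum umbral_monom
    by (simp add: monom_altdef pcompose_smult pcompose_power umbral_smult sum.distrib ring_distribs
        pcompose_pCons)
  also have "\<dots> = 2 * poly p z"
    by (simp add: monom poly_altdef sum_distrib_left mult_ac)
  finally show ?thesis
    by (simp add: poly_as_sum_of_monoms)
qed

section \<open>Pochhammer polynomials and the central bases\<close>

lemma pcompose_of_nat: "pcompose (of_nat n) q = of_nat n"
  by (simp add: of_nat_poly)

lemma pcompose_pochhammer: "pcompose (pochhammer p n) q = pochhammer (pcompose p q) n"
  by (induction n) (simp_all add: pochhammer_Suc pcompose_1 pcompose_mult pcompose_add pcompose_of_nat)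

lemma linear_add_of_nat: "[:c, e:] + of_nat n = [:c + of_nat n, e:]"
  by (simp add: of_nat_poly)

lemma pochhammer_linear:
  fixes c e :: "'a :: idom"
  assumes "e \<noteq> 0"
  shows degree_pochhammer_linear: "degree (pochhammer [:c, e:] n) = n"
    and lead_coeff_pochhammer_linear: "lead_coeff (pochhammer [:c, e:] n) = e ^ n"
proof -
  have nz: "pochhammer [:c, e:] n \<noteq> 0" for n
    using assms by (induction n) (auto simp: pochhammer_Suc linear_add_of_nat simp del: mult_pCons_right)
  show deg: "degree (pochhammer [:c, e:] n) = n" for n
    using assms by (induction n)
      (simp_all add: pochhammer_Suc linear_add_of_nat degree_mult_eq nz del: mult_pCons_right)
  show "lead_coeff (pochhammer [:c, e:] n) = e ^ n"
    using assms by (induction n)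
      (simp_all add: pochhammer_Suc linear_add_of_nat lead_coeff_mult del: mult_pCons_right)
qed

text \<open>For \<open>X\<close> on the imaginary axis, the basis underlying the continuous dual Hahn polynomials.\<close>

definition central_pochhammer :: "'a :: comm_ring_1 \<Rightarrow> nat \<Rightarrow> 'a poly" where
  "central_pochhammer a n = pochhammer [:a, 1:] n * pochhammer [:a, -1:] n"

lemma central_pochhammer_0 [simp]: "central_pochhammer a 0 = 1"
  by (simp add: central_pochhammer_def)

lemma central_pochhammer_Suc:
  "central_pochhammer a (Suc n) = central_pochhammer a n * [:(a + of_nat n)\<^sup>2, 0, -1:]"
proof -
  have "[:a + of_nat n, 1:] * [:a + of_nat n, -1:] = [:(a + of_nat n)\<^sup>2, 0, -1:]"
    by (simp add: power2_eq_square algebra_simps)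
  then show ?thesis
    by (simp add: central_pochhammer_def pochhammer_Suc linear_add_of_nat mult_ac
        del: mult_pCons_left mult_pCons_right)
qed

text \<open>Central Pochhammer polynomials are even in X, so the extra factor X at odd
  \<open>i\<close> supplies the odd degrees. The split of \<open>i\<close> matches the blocks of
  \<open>det_factorial_blocks\<close>.\<close>

definition central_basis :: "'a :: comm_ring_1 \<Rightarrow> nat \<Rightarrow> 'a poly" where
  "central_basis a i = [:0, 1:] ^ (i mod 2) * central_pochhammer a (i div 2)"

lemma central_basis:
  fixes a :: "'a :: idom"
  shows degree_central_basis: "degree (central_basis a i) = i"
    and lead_coeff_central_basis: "lead_coeff (central_basis a i) = (- 1) ^ (i div 2)"
proof -
  have nz: "pochhammer [:a, e:] n \<noteq> 0" if "e \<noteq> 0" for e n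
    using lead_coeff_pochhammer_linear[OF that, of a n] that by auto
  have "degree (central_basis a i) = i mod 2 + (i div 2 + i div 2)"
    by (simp add: central_basis_def central_pochhammer_def degree_mult_eq nz
        degree_pochhammer_linear degree_linear_power)
  then show "degree (central_basis a i) = i"
    by presburger
  show "lead_coeff (central_basis a i) = (- 1) ^ (i div 2)"
    using lead_coeff_pochhammer_linear[of 1 a "i div 2"]
      lead_coeff_pochhammer_linear[of "-1" a "i div 2"]
    by (simp add: central_basis_def central_pochhammer_def lead_coeff_mult lead_coeff_power)
qed

text \<open>Only the test polynomials vanishing at both \<delta> and -\<delta> enter, so one set of
  recurrences covers both signs; the two cases differ later only in the values of \<open>M 1\<close>
  and \<open>M [:0, 1:]\<close>.\<close>

locale symmetric_functional =
  fixes c :: "nat \<Rightarrow> 'a :: field_char_0" and h \<delta> :: 'a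
  assumes vanish: "\<And>p. poly p \<delta> = 0 \<Longrightarrow> poly p (- \<delta>) = 0 \<Longrightarrow>
    umbral c (pcompose (pcompose p [:1/2, 1:] + pcompose p [:-1/2, 1:]) [:-h, 1:]) = 0"
begin

section \<open>Values of the functional on products of central polynomials\<close>

definition M :: "'a poly \<Rightarrow> 'a" where
  "M p = umbral c (pcompose p [:-h, 1:])"

definition a :: 'a where "a = 1/2 + \<delta>"

definition b :: 'a where "b = 1/2 - \<delta>"

lemma M_add: "M (p + q) = M p + M q"
  by (simp add: M_def pcompose_add umbral_add)

lemma M_smult: "M (smult x p) = x * M p"
  by (simp add: M_def pcompose_smult umbral_smult)

lemma M_1: "M 1 = c 0"
  by (simp add: M_def pcompose_1 umbral_def)

lemma M_X: "M [:0, 1:] = c 1 - h * c 0"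
  by (simp add: M_def pcompose_pCons umbral_def)

text \<open>A shift by 1/2 turns one of \<delta> + X, \<delta> - X into a linear polynomial with
  constant term \<open>a\<close> and the other into one with constant term \<open>a - 1\<close>.
  Peeling off the last factor of the first product and the first factor of the second leaves
  \<open>central_pochhammer a n\<close> in both shifts.\<close>

lemma central_shift:
  fixes n :: nat
  defines "p \<equiv> central_pochhammer \<delta> (Suc n)"
  shows "pcompose p [:1/2, 1:] = central_pochhammer a n * ([:a + of_nat n, 1:] * [:a - 1, -1:])"
    and "pcompose p [:-1/2, 1:] = central_pochhammer a n * ([:a - 1, 1:] * [:a + of_nat n, -1:])"
    and "poly p \<delta> = 0" and "poly p (- \<delta>) = 0"
proof -
  have eq: "pcompose [:\<delta>, 1:] [:1/2, 1:] = [:a, 1:]" "pcompose [:\<delta>, -1:] [:1/2, 1:] = [:a - 1, -1:]"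
    "pcompose [:\<delta>, 1:] [:-1/2, 1:] = [:a - 1, 1:]" "pcompose [:\<delta>, -1:] [:-1/2, 1:] = [:a, -1:]"
    by (simp_all add: pcompose_pCons a_def)
  have shift: "[:a - 1, e:] + 1 = [:a, e:]" for e
    by (simp add: one_pCons)
  have rec: "pochhammer [:a - 1, e:] (Suc n) = [:a - 1, e:] * pochhammer [:a, e:] n" for e
    by (simp only: pochhammer_rec shift)
  have Suc: "pochhammer [:a, e:] (Suc n) = pochhammer [:a, e:] n * [:a + of_nat n, e:]" for e
    by (simp only: pochhammer_Suc linear_add_of_nat)
  show "pcompose p [:1/2, 1:] = central_pochhammer a n * ([:a + of_nat n, 1:] * [:a - 1, -1:])"
    "pcompose p [:-1/2, 1:] = central_pochhammer a n * ([:a - 1, 1:] * [:a + of_nat n, -1:])"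
    unfolding p_def central_pochhammer_def pcompose_mult pcompose_pochhammer eq rec Suc
    by (simp_all only: mult_ac)
  have "p = [:\<delta>, 1:] * [:\<delta>, -1:] * (pochhammer ([:\<delta>, 1:] + 1) n * pochhammer ([:\<delta>, -1:] + 1) n)"
    by (simp only: p_def central_pochhammer_def pochhammer_rec mult_ac)
  then show "poly p \<delta> = 0" "poly p (- \<delta>) = 0"
    by (simp_all del: mult_pCons_left mult_pCons_right)
qed

text \<open>The two cofactors from \<open>central_shift\<close> add up to twice the next factor (a +
  n)^2 - X^2 minus the constant 2 (n + 1) (a + n). Hence the recurrence M(u_{n+1}) = (n + 1) (a + n)
  M(u_n).\<close>

lemma M_central:
  "M (central_pochhammer a n) = M 1 * fact n * pochhammer a n"
proof (induction n)
  case (Suc n)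
  let ?U = "central_pochhammer a n"
  have "[:a + of_nat n, 1:] * [:a - 1, -1:] + [:a - 1, 1:] * [:a + of_nat n, -1:]
    = smult 2 [:(a + of_nat n)\<^sup>2, 0, -1:] + smult (- (2 * (of_nat n + 1) * (a + of_nat n))) 1"
    by (simp add: one_pCons power2_eq_square algebra_simps)
  then have eq: "pcompose (central_pochhammer \<delta> (Suc n)) [:1/2, 1:]
      + pcompose (central_pochhammer \<delta> (Suc n)) [:-1/2, 1:]
    = smult 2 (central_pochhammer a (Suc n)) + smult (- (2 * (of_nat n + 1) * (a + of_nat n))) ?U"
    unfolding central_shift central_pochhammer_Suc[of a]
    by (simp only: ring_distribs(1)[symmetric]) (simp only: ring_distribs mult_smult_right mult_1_right)
  have "2 * M (central_pochhammer a (Suc n)) + - (2 * (of_nat n + 1) * (a + of_nat n)) * M ?U = 0"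
    using vanish[OF central_shift(3,4)[of n]]
    unfolding M_def[symmetric] eq by (simp only: M_add M_smult)
  then have "2 * M (central_pochhammer a (Suc n)) = 2 * ((of_nat n + 1) * (a + of_nat n) * M ?U)"
    by (simp only: mult_minus_left add_uminus_conv_diff right_minus_eq mult.assoc)
  then have "M (central_pochhammer a (Suc n)) = (of_nat n + 1) * (a + of_nat n) * M ?U"
    by (simp del: mult_pCons_left)
  then show ?case
    using Suc.IH by (simp add: pochhammer_Suc algebra_simps)
qed simp

text \<open>The same argument with test polynomial X times the previous one. The factor X becomes X
  + 1/2 and X - 1/2, and the halves contribute -(n + 1) X, which replaces a + n by a + 1/2 + n in
  the recurrence.\<close>

lemma M_X_central:
  "M ([:0, 1:] * central_pochhammer a n) = M [:0, 1:] * fact n * pochhammer (a + 1/2) n"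
proof (induction n)
  case (Suc n)
  let ?X = "[:0, 1:] :: 'a poly" and ?U = "central_pochhammer a n"
  let ?p = "?X * central_pochhammer \<delta> (Suc n)"
  have comp: "pcompose ?X q = q" for q
    by (simp add: pcompose_pCons)
  have "[:1/2, 1:] * ([:a + of_nat n, 1:] * [:a - 1, -1:])
      + [:-1/2, 1:] * ([:a - 1, 1:] * [:a + of_nat n, -1:])
    = smult 2 (?X * [:(a + of_nat n)\<^sup>2, 0, -1:])
      + smult (- (2 * (of_nat n + 1) * (a + 1/2 + of_nat n))) ?X"
    by (simp add: power2_eq_square field_simps)
  then have "?U * ([:1/2, 1:] * ([:a + of_nat n, 1:] * [:a - 1, -1:])
      + [:-1/2, 1:] * ([:a - 1, 1:] * [:a + of_nat n, -1:]))
    = ?U * (smult 2 (?X * [:(a + of_nat n)\<^sup>2, 0, -1:])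
      + smult (- (2 * (of_nat n + 1) * (a + 1/2 + of_nat n))) ?X)"
    by (rule arg_cong)
  then have eq: "pcompose ?p [:1/2, 1:] + pcompose ?p [:-1/2, 1:]
    = smult 2 (?X * central_pochhammer a (Suc n))
      + smult (- (2 * (of_nat n + 1) * (a + 1/2 + of_nat n))) (?X * ?U)"
    unfolding pcompose_mult[of ?X] comp central_shift central_pochhammer_Suc[of a]
    by (simp only: ring_distribs mult_smult_right mult_smult_left mult_ac)
  have "poly ?p \<delta> = 0" "poly ?p (- \<delta>) = 0"
    by (simp_all only: poly_mult central_shift mult_zero_right)
  then have "2 * M (?X * central_pochhammer a (Suc n))
    + - (2 * (of_nat n + 1) * (a + 1/2 + of_nat n)) * M (?X * ?U) = 0"
    using vanish[of ?p] unfolding M_def[symmetric] eq by (simp only: M_add M_smult)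
  then have "2 * M (?X * central_pochhammer a (Suc n))
    = 2 * ((of_nat n + 1) * (a + 1/2 + of_nat n) * M (?X * ?U))"
    by (simp only: mult_minus_left add_uminus_conv_diff right_minus_eq mult.assoc)
  then have "M (?X * central_pochhammer a (Suc n)) = (of_nat n + 1) * (a + 1/2 + of_nat n) * M (?X * ?U)"
    by (simp del: mult_pCons_left)
  then show ?case
    unfolding Suc.IH
    by (simp add: pochhammer_Suc mult_ac add_ac del: mult_pCons_left mult_pCons_right)
qed simp

text \<open>The next factors of the two bases, (a + n)^2 - X^2 and (b + k)^2 - X^2, differ by a
  constant, so \<open>k\<close> can be raised at the cost of raising \<open>n\<close>. It is applied
  with \<open>Q = 1\<close>, \<open>e = 0\<close> and with \<open>Q = [:0, 1:]\<close>,
  \<open>e = 1/2\<close>.\<close>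

lemma M_central_central:
  assumes "\<And>n. M (Q * central_pochhammer a n) = M Q * fact n * pochhammer (a + e) n"
  shows "M (Q * (central_pochhammer a n * central_pochhammer b k))
    = M Q * fact (n + k) * pochhammer (a + e) n * pochhammer (b + e) k"
proof (induction k arbitrary: n)
  case 0
  then show ?case
    using assms by simp
next
  case (Suc k)
  let ?U = "central_pochhammer a" and ?V = "central_pochhammer b"
  \<comment> \<open>This is (a + n)^2 - (b + k)^2, factored using a + b = 1.\<close>
  define s where "s = (of_nat (n + k) + 1) * (a + of_nat n - b - of_nat k)"
  have "[:(a + of_nat n)\<^sup>2, 0, -1:] = [:(b + of_nat k)\<^sup>2, 0, -1:] + smult s 1"
    by (simp add: one_pCons s_def a_def b_def power2_eq_square field_simps)
  then have "Q * (?U (Suc n) * ?V k) = Q * (?U n * ?V (Suc k)) + smult s (Q * (?U n * ?V k))"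
    unfolding central_pochhammer_Suc
    by (simp only: ring_distribs mult_smult_right mult_smult_left mult_1_left mult_1_right mult_ac)
  then have "M (Q * (?U n * ?V (Suc k)))
    = M (Q * (?U (Suc n) * ?V k)) - s * M (Q * (?U n * ?V k))"
    by (simp add: M_add M_smult)
  also have "\<dots> = M Q * fact (n + k) * pochhammer (a + e) n * pochhammer (b + e) k
    * (of_nat (n + k) + 1) * ((a + e + of_nat n) - (a + of_nat n - b - of_nat k))"
    unfolding Suc.IH by (simp add: pochhammer_Suc s_def algebra_simps)
  also have "\<dots> = M Q * fact (n + Suc k) * pochhammer (a + e) n * pochhammer (b + e) (Suc k)"
    by (simp add: pochhammer_Suc algebra_simps)
  finally show ?case .
qed

text \<open>Write X^2 as (a + n)^2 minus the next factor of u_n. The factorial stays (n + k)!, and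
  only the row and column factors move up by one, so these entries fit the shape of
  \<open>det_factorial_blocks\<close>.\<close>

lemma M_XX_central_central:
  "M ([:0, 1:]\<^sup>2 * (central_pochhammer a n * central_pochhammer b k))
    = - M 1 * fact (n + k) * pochhammer a (Suc n) * pochhammer b (Suc k)"
proof -
  let ?U = "central_pochhammer a" and ?V = "central_pochhammer b"
  have M: "M (?U n * ?V k) = M 1 * fact (n + k) * pochhammer a n * pochhammer b k" for n k
    using M_central_central[of 1 0] by (simp add: M_central)
  have "[:0, 1:]\<^sup>2 = smult ((a + of_nat n)\<^sup>2) 1 + smult (- 1) [:(a + of_nat n)\<^sup>2, 0, -1:]"
    by (simp add: power2_eq_square one_pCons)
  then have "[:0, 1:]\<^sup>2 * (?U n * ?V k)
    = smult ((a + of_nat n)\<^sup>2) (?U n * ?V k) + smult (- 1) (?U (Suc n) * ?V k)"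
    unfolding central_pochhammer_Suc
    by (simp only: ring_distribs mult_smult_right mult_smult_left mult_1_left mult_ac)
  then have "M ([:0, 1:]\<^sup>2 * (?U n * ?V k))
    = (a + of_nat n)\<^sup>2 * M (?U n * ?V k) - M (?U (Suc n) * ?V k)"
    by (simp only: M_add M_smult) simp
  also have "\<dots> = M 1 * fact (n + k) * pochhammer a n * pochhammer b k
    * (a + of_nat n) * ((a + of_nat n) - (of_nat (n + k) + 1))"
    unfolding M by (simp add: pochhammer_Suc power2_eq_square algebra_simps)
  also have "(a + of_nat n) - (of_nat (n + k) + 1) = - (b + of_nat k)"
    by (simp add: a_def b_def)
  finally show ?thesis
    by (simp add: pochhammer_Suc algebra_simps)
qed

text \<open>Recentring keeps leading coefficients, and the two bases have the same sign (-1)^(i div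
  2) in degree \<open>i\<close>, so the change of basis has determinant 1.\<close>

lemma hankel_det_central_basis:
  "hankel_det c n = det (mat (n + 1) (n + 1) (\<lambda>(i, j). M (central_basis a i * central_basis b j)))"
proof -
  have "(\<lambda>(i, j). M (central_basis a i * central_basis b j)) = (\<lambda>(i, j).
      umbral c (pcompose (central_basis a i) [:-h, 1:] * pcompose (central_basis b j) [:-h, 1:]))"
    by (simp add: M_def pcompose_mult)
  then have "det (mat (n + 1) (n + 1) (\<lambda>(i, j). M (central_basis a i * central_basis b j)))
    = (\<Prod>i<n + 1. lead_coeff (pcompose (central_basis a i) [:-h, 1:])
        * lead_coeff (pcompose (central_basis b i) [:-h, 1:])) * hankel_det c n"
    using det_umbral_mult[of n "\<lambda>i. pcompose (central_basis a i) [:-h, 1:]"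
        "\<lambda>i. pcompose (central_basis b i) [:-h, 1:]" c]
    by (simp add: degree_pcompose degree_central_basis)
  also have "(\<Prod>i<n + 1. lead_coeff (pcompose (central_basis a i) [:-h, 1:])
        * lead_coeff (pcompose (central_basis b i) [:-h, 1:])) = 1"
    by (intro prod.neutral)
      (simp add: lead_coeff_comp lead_coeff_central_basis power_add[symmetric] mult_2[symmetric])
  finally show ?thesis
    by simp
qed

lemma M_central_basis:
  "M (central_basis a i * central_basis b j) = M ([:0, 1:] ^ (i mod 2 + j mod 2)
    * (central_pochhammer a (i div 2) * central_pochhammer b (j div 2)))"
  by (simp only: central_basis_def power_add mult_ac)

text \<open>When \<open>M [:0, 1:]\<close> vanishes, entries of mixed parity vanish and the blocks
  are diagonal with entries \<open>M 1\<close> and \<open>- M 1\<close>. The index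
  \<open>(i + 1) div 2\<close> absorbs the extra Pochhammer factor of the odd rows and
  columns.\<close>

lemma hankel_det_even:
  assumes "M [:0, 1:] = 0"
  shows "hankel_det c n = (\<Prod>i<n + 1. pochhammer a ((i + 1) div 2) * pochhammer b ((i + 1) div 2)
    * (fact (i div 2))\<^sup>2) * (\<Prod>i<n + 1. if even i then M 1 else - M 1)"
proof -
  define \<kappa> :: "nat \<Rightarrow> nat \<Rightarrow> 'a" where
    "\<kappa> p q = (if p \<noteq> q then 0 else if p = 0 then M 1 else - M 1)" for p q
  have entry: "M (central_basis a i * central_basis b j) = pochhammer a ((i + 1) div 2)
    * pochhammer b ((j + 1) div 2) * fact (i div 2 + j div 2) * \<kappa> (i mod 2) (j mod 2)" for i j
  proof -
    consider "i mod 2 = 0" "j mod 2 = 0" | "i mod 2 \<noteq> j mod 2" "i mod 2 + j mod 2 = 1"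
      | "i mod 2 = 1" "j mod 2 = 1"
      by linarith
    then show ?thesis
    proof cases
      case 1
      then show ?thesis
        using M_central_central[of 1 0 "i div 2" "j div 2"]
        by (auto simp: M_central_basis M_central \<kappa>_def elim!: evenE)
    next
      case 2
      then show ?thesis
        using M_central_central[of "[:0, 1:]" "1/2" "i div 2" "j div 2"] M_X_central
        unfolding M_central_basis \<kappa>_def by (simp add: assms del: mult_pCons_left)
    next
      case 3
      then have "(i + 1) div 2 = Suc (i div 2)" "(j + 1) div 2 = Suc (j div 2)"
        by presburger+
      then show ?thesis
        using 3 M_XX_central_central[of "i div 2" "j div 2"]
        unfolding M_central_basis \<kappa>_def by (simp add: numeral_2_eq_2 mult_ac del: mult_pCons_left)
    qed
  qed
  have diag: "\<kappa> (i mod 2) (i mod 2) = (if even i then M 1 else - M 1)" for i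
    by (simp only: \<kappa>_def even_iff_mod_2_eq_zero) simp
  have "hankel_det c n = (\<Prod>i<n + 1. pochhammer a ((i + 1) div 2) * pochhammer b ((i + 1) div 2)
    * (fact (i div 2))\<^sup>2) * det (mat (n + 1) (n + 1)
      (\<lambda>(i, j). if i div 2 = j div 2 then \<kappa> (i mod 2) (j mod 2) else 0))"
    unfolding hankel_det_central_basis entry by (rule det_factorial_blocks)
  also have "det (mat (n + 1) (n + 1)
      (\<lambda>(i, j). if i div 2 = j div 2 then \<kappa> (i mod 2) (j mod 2) else 0))
    = (\<Prod>i<n + 1. if even i then M 1 else - M 1)"
  proof (subst det_lower_triangular_prod[of _ "n + 1"])
    fix i j :: nat assume "i < j" "j < n + 1"
    moreover from this have "i div 2 \<noteq> j div 2 \<or> i mod 2 \<noteq> j mod 2"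
      by (metis mult_div_mod_eq less_irrefl)
    ultimately show "mat (n + 1) (n + 1) (\<lambda>(i, j). if i div 2 = j div 2
        then \<kappa> (i mod 2) (j mod 2) else 0) $$ (i, j) = 0"
      by (auto simp: \<kappa>_def)
  qed (simp_all add: diag)
  finally show ?thesis .
qed

text \<open>When \<open>M 1\<close> vanishes, only entries of mixed parity survive, so each block is
  antidiagonal with entries \<open>M [:0, 1:]\<close>.\<close>

lemma hankel_det_odd:
  assumes "M 1 = 0"
  shows "hankel_det c n = (\<Prod>i<n + 1. pochhammer (a + 1/2) (i div 2) * pochhammer (b + 1/2) (i div 2)
    * (fact (i div 2))\<^sup>2) * det (mat (n + 1) (n + 1)
      (\<lambda>(i, j). if i div 2 = j div 2 \<and> i \<noteq> j then M [:0, 1:] else 0))"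
proof -
  define \<kappa> :: "nat \<Rightarrow> nat \<Rightarrow> 'a" where "\<kappa> p q = (if p = q then 0 else M [:0, 1:])" for p q
  have entry: "M (central_basis a i * central_basis b j) = pochhammer (a + 1/2) (i div 2)
    * pochhammer (b + 1/2) (j div 2) * fact (i div 2 + j div 2) * \<kappa> (i mod 2) (j mod 2)" for i j
  proof -
    consider "i mod 2 = 0" "j mod 2 = 0" | "i mod 2 \<noteq> j mod 2" "i mod 2 + j mod 2 = 1"
      | "i mod 2 = 1" "j mod 2 = 1"
      by linarith
    then show ?thesis
    proof cases
      case 1
      then show ?thesis
        using M_central_central[of 1 0 "i div 2" "j div 2"]
        by (simp add: M_central_basis M_central \<kappa>_def assms)
    next
      case 2
      then show ?thesis
        using M_central_central[of "[:0, 1:]" "1/2" "i div 2" "j div 2"] M_X_central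
        unfolding M_central_basis \<kappa>_def by (simp add: mult_ac del: mult_pCons_left)
    next
      case 3
      then show ?thesis
        using M_XX_central_central[of "i div 2" "j div 2"]
        unfolding M_central_basis \<kappa>_def by (simp add: numeral_2_eq_2 assms del: mult_pCons_left)
    qed
  qed
  have "i div 2 = j div 2 \<Longrightarrow> i mod 2 = j mod 2 \<longleftrightarrow> i = j" for i j :: nat
    by (metis mult_div_mod_eq)
  then have "(\<lambda>(i, j). if i div 2 = j div 2 then \<kappa> (i mod 2) (j mod 2) else 0)
    = (\<lambda>(i, j). if i div 2 = j div 2 \<and> i \<noteq> j then M [:0, 1:] else 0)"
    by (intro ext) (auto simp: \<kappa>_def)
  then show ?thesis
    unfolding hankel_det_central_basis entry det_factorial_blocks[of "n + 1" _ _ \<kappa>]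
    by (rule arg_cong)
qed

end

section \<open>Sums and differences of Euler polynomials as symmetric functionals\<close>

lemma euler_poly_0: "euler_poly 0 z = 1"
  using sum_choose_euler_poly[of 0 z] by simp

lemma euler_poly_1: "euler_poly 1 z = z - 1/2"
proof -
  have "1 + 2 * euler_poly 1 z = 2 * z"
    using sum_choose_euler_poly[of 1 z] by (simp add: euler_poly_0 add.commute)
  then show ?thesis
    by (simp add: field_simps eq_diff_eq)
qed

lemma symmetric_functional_euler:
  fixes A B \<sigma> :: "'a :: field_char_0"
  shows "symmetric_functional (\<lambda>k. euler_poly k A + \<sigma> * euler_poly k B) ((A + B - 1) / 2) ((B - A) / 2)"
proof
  fix p :: "'a poly"
  assume p: "poly p ((B - A) / 2) = 0" "poly p (- ((B - A) / 2)) = 0"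
  define h where "h = (A + B - 1) / 2"
  \<comment> \<open>With this shift the two half-steps become P(X + 1) + P(X), and the evaluation
    points \<open>A\<close> and \<open>B\<close> are carried to -\<delta> and \<delta>, where
    \<open>p\<close> vanishes.\<close>
  define P where "P = pcompose p [:-1/2 - h, 1:]"
  have umb: "umbral (\<lambda>k. euler_poly k A + \<sigma> * euler_poly k B) r
      = euler_functional A r + \<sigma> * euler_functional B r" for r
    by (simp add: euler_functional_def umbral_def sum.distrib sum_distrib_left algebra_simps)
  have "pcompose (pcompose p [:1/2, 1:] + pcompose p [:-1/2, 1:]) [:-h, 1:] = pcompose P [:1, 1:] + P"
    by (simp add: P_def pcompose_add pcompose_assoc[symmetric] pcompose_pCons)
  then have "umbral (\<lambda>k. euler_poly k A + \<sigma> * euler_poly k B)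
      (pcompose (pcompose p [:1/2, 1:] + pcompose p [:-1/2, 1:]) [:-h, 1:])
    = 2 * poly P A + \<sigma> * (2 * poly P B)"
    using euler_functional_shift[of A P] euler_functional_shift[of B P]
    by (simp add: umb) (simp add: euler_functional_def umbral_add algebra_simps flip: distrib_left)
  also have "poly P A = poly p (- ((B - A) / 2))"
  proof -
    have "poly [:-1/2 - h, 1:] A = - ((B - A) / 2)"
      by (simp add: h_def field_simps)
    then show ?thesis
      by (simp only: P_def poly_pcompose)
  qed
  also have "poly P B = poly p ((B - A) / 2)"
  proof -
    have "poly [:-1/2 - h, 1:] B = (B - A) / 2"
      by (simp add: h_def field_simps)
    then show ?thesis
      by (simp only: P_def poly_pcompose)
  qed
  finally show "umbral (\<lambda>k. euler_poly k A + \<sigma> * euler_poly k B)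
      (pcompose (pcompose p [:1/2, 1:] + pcompose p [:-1/2, 1:]) [:-((A + B - 1) / 2), 1:]) = 0"
    by (simp add: p h_def)
qed

section \<open>Rewriting the diagonal products in the stated closed forms\<close>

lemma minus_one_power_mult_square: "((- 1) ^ n * x)\<^sup>2 = (x :: 'a :: comm_ring_1)\<^sup>2"
  by (cases "even n") simp_all

text \<open>Passing from \<open>m\<close> to \<open>Suc m\<close> raises every old exponent by 2 and
  adds a new factor with exponent 2, hence the square of a plain product. This drives the inductions
  below.\<close>

lemma prod_power_Suc:
  fixes t :: "nat \<Rightarrow> 'a :: comm_semiring_1"
  shows "(\<Prod>l = 1..Suc m. t l ^ (2 * (Suc m + 1 - l)))
    = (\<Prod>l = 1..m. t l ^ (2 * (m + 1 - l))) * (\<Prod>l = 1..Suc m. t l)\<^sup>2"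
proof -
  have "(\<Prod>l = 1..m. t l ^ (2 * (Suc m + 1 - l)))
    = (\<Prod>l = 1..m. t l ^ (2 * (m + 1 - l)) * (t l)\<^sup>2)"
    by (intro prod.cong) (simp_all add: Suc_diff_le power2_eq_square mult_ac)
  then show ?thesis
    by (simp add: prod.distrib prod_power_distrib power_mult_distrib mult_ac)
qed

lemma prod_power_Suc':
  fixes f t :: "nat \<Rightarrow> 'a :: comm_semiring_1"
  shows "(\<Prod>l = 0..Suc m. f l * t l ^ (2 * (Suc m - l) + 1))
    = (\<Prod>l = 0..m. f l * t l ^ (2 * (m - l) + 1)) * (\<Prod>l = 0..m. t l)\<^sup>2 * f (Suc m) * t (Suc m)"
proof -
  have "(\<Prod>l = 0..m. f l * t l ^ (2 * (Suc m - l) + 1))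
    = (\<Prod>l = 0..m. f l * t l ^ (2 * (m - l) + 1) * (t l)\<^sup>2)"
    by (intro prod.cong) (simp_all add: Suc_diff_le power_add[symmetric] mult.assoc)
  then show ?thesis
    by (simp add: prod.distrib prod_power_distrib mult_ac)
qed

lemma prod_pochhammer_odd:
  fixes d :: "'a :: field_char_0"
  shows "(\<Prod>l = 1..m. (of_nat l)\<^sup>2 / 4 * (d\<^sup>2 - (2 * of_nat l - 1)\<^sup>2))
    = (- 1) ^ m * (fact m)\<^sup>2 * (pochhammer (1/2 + d/2) m * pochhammer (1/2 - d/2) m)"
proof (induction m)
  case (Suc m)
  have eq: "(d\<^sup>2 - (2 * of_nat (Suc m) - 1)\<^sup>2)
    = - 4 * ((1/2 + d/2 + of_nat m) * (1/2 - d/2 + of_nat m))"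
    by (simp add: field_simps power2_eq_square)
  have "(\<Prod>l = 1..Suc m. (of_nat l)\<^sup>2 / 4 * (d\<^sup>2 - (2 * of_nat l - 1)\<^sup>2))
    = (- 1) ^ m * (fact m)\<^sup>2 * (pochhammer (1/2 + d/2) m * pochhammer (1/2 - d/2) m)
      * ((of_nat (Suc m))\<^sup>2 / 4 * (d\<^sup>2 - (2 * of_nat (Suc m) - 1)\<^sup>2))"
    by (subst prod.nat_ivl_Suc', simp) (subst mult.commute, simp only: Suc.IH)
  also have "\<dots> = (- 1) ^ m * (- 1) * (of_nat (Suc m) * fact m)\<^sup>2
      * ((pochhammer (1/2 + d/2) m * (1/2 + d/2 + of_nat m))
        * (pochhammer (1/2 - d/2) m * (1/2 - d/2 + of_nat m)))"
    unfolding eq by (simp only: power_mult_distrib) (simp add: mult_ac)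
  finally show ?case
    by (simp only: pochhammer_Suc fact_Suc power_Suc2)
qed simp

lemma prod_pochhammer_even:
  fixes d :: "'a :: field_char_0"
  shows "(\<Prod>l = 1..m. (of_nat l)\<^sup>2 / 4 * (d\<^sup>2 - (2 * of_nat l)\<^sup>2))
    = (- 1) ^ m * (fact m)\<^sup>2 * (pochhammer (1 + d/2) m * pochhammer (1 - d/2) m)"
proof (induction m)
  case (Suc m)
  have eq: "(d\<^sup>2 - (2 * of_nat (Suc m))\<^sup>2)
    = - 4 * ((1 + d/2 + of_nat m) * (1 - d/2 + of_nat m))"
    by (simp add: field_simps power2_eq_square)
  have "(\<Prod>l = 1..Suc m. (of_nat l)\<^sup>2 / 4 * (d\<^sup>2 - (2 * of_nat l)\<^sup>2))
    = (- 1) ^ m * (fact m)\<^sup>2 * (pochhammer (1 + d/2) m * pochhammer (1 - d/2) m)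
      * ((of_nat (Suc m))\<^sup>2 / 4 * (d\<^sup>2 - (2 * of_nat (Suc m))\<^sup>2))"
    by (subst prod.nat_ivl_Suc', simp) (subst mult.commute, simp only: Suc.IH)
  also have "\<dots> = (- 1) ^ m * (- 1) * (of_nat (Suc m) * fact m)\<^sup>2
      * ((pochhammer (1 + d/2) m * (1 + d/2 + of_nat m))
        * (pochhammer (1 - d/2) m * (1 - d/2 + of_nat m)))"
    unfolding eq by (simp only: power_mult_distrib) (simp add: mult_ac)
  finally show ?case
    by (simp only: pochhammer_Suc fact_Suc power_Suc2)
qed simp

lemma prod_pochhammer_odd':
  fixes d :: "'a :: field_char_0"
  shows "(\<Prod>l = 0..m. d\<^sup>2 - (2 * of_nat l + 1)\<^sup>2)
    = (- 4) ^ Suc m * (pochhammer (1/2 + d/2) (Suc m) * pochhammer (1/2 - d/2) (Suc m))"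
proof (induction m)
  case 0
  show ?case
    by (simp add: field_simps power2_eq_square)
next
  case (Suc m)
  let ?m = "Suc m"
  have eq: "d\<^sup>2 - (2 * of_nat ?m + 1)\<^sup>2 = - 4 * ((1/2 + d/2 + of_nat ?m) * (1/2 - d/2 + of_nat ?m))"
    by (simp add: field_simps power2_eq_square)
  have "(\<Prod>l = 0..?m. d\<^sup>2 - (2 * of_nat l + 1)\<^sup>2)
    = (- 4) ^ ?m * (pochhammer (1/2 + d/2) ?m * pochhammer (1/2 - d/2) ?m)
      * (d\<^sup>2 - (2 * of_nat ?m + 1)\<^sup>2)"
    by (simp only: prod.atLeast0_atMost_Suc Suc.IH)
  also have "\<dots> = (- 4) ^ ?m * (- 4)
      * ((pochhammer (1/2 + d/2) ?m * (1/2 + d/2 + of_nat ?m))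
        * (pochhammer (1/2 - d/2) ?m * (1/2 - d/2 + of_nat ?m)))"
    unfolding eq by (simp only: mult_ac)
  finally show ?case
    by (simp only: pochhammer_Suc[of _ ?m] power_Suc2[of _ ?m])
qed

text \<open>The induction step adds the indices 2m + 1 and 2m + 2, both with
  \<open>w (Suc m)\<close> but with squared factorials of m and of m + 1. This mismatch accounts for
  the denominator m!^2.\<close>

lemma prod_plus_even:
  fixes d :: "'a :: field_char_0"
  defines "w \<equiv> \<lambda>n. pochhammer (1/2 + d/2) n * pochhammer (1/2 - d/2) n"
  shows "(\<Prod>i<2 * m + 1. w ((i + 1) div 2) * (fact (i div 2))\<^sup>2)
      * (\<Prod>i<2 * m + 1. if even i then 2 else - 2)
    = (- 1) ^ m * (2 ^ (2 * m + 1) / (fact m)\<^sup>2)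
      * (\<Prod>l = 1..m. ((of_nat l)\<^sup>2 / 4 * (d\<^sup>2 - (2 * of_nat l - 1)\<^sup>2)) ^ (2 * (m + 1 - l)))"
proof (induction m)
  case 0
  show ?case
    by (simp add: w_def)
next
  case (Suc m)
  let ?L = "\<lambda>m. (\<Prod>i<2 * m + 1. w ((i + 1) div 2) * (fact (i div 2))\<^sup>2)
      * (\<Prod>i<2 * m + 1. if even i then 2 else - 2 :: 'a)"
  let ?P = "\<lambda>m. \<Prod>l = 1..m. ((of_nat l)\<^sup>2 / 4 * (d\<^sup>2 - (2 * of_nat l - 1)\<^sup>2)) ^ (2 * (m + 1 - l))"
  have "?L (Suc m) = ?L m * (- 4) * (w (Suc m) * (fact m)\<^sup>2) * (w (Suc m) * (fact (Suc m))\<^sup>2)"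
    by (simp add: mult_ac)
  also have "\<dots> = (- 1) ^ Suc m * (2 ^ (2 * Suc m + 1) / (fact (Suc m))\<^sup>2)
      * (?P m * ((fact (Suc m))\<^sup>2 * w (Suc m))\<^sup>2)"
    unfolding Suc.IH by (simp add: field_simps power2_eq_square del: fact_Suc)
  also have "?P m * ((fact (Suc m))\<^sup>2 * w (Suc m))\<^sup>2 = ?P (Suc m)"
    by (simp only: prod_power_Suc prod_pochhammer_odd w_def mult.assoc minus_one_power_mult_square)
  finally show ?case .
qed

lemma prod_plus_odd:
  fixes d :: "'a :: field_char_0"
  defines "w \<equiv> \<lambda>n. pochhammer (1/2 + d/2) n * pochhammer (1/2 - d/2) n"
  shows "(\<Prod>i<2 * m + 2. w ((i + 1) div 2) * (fact (i div 2))\<^sup>2)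
      * (\<Prod>i<2 * m + 2. if even i then 2 else - 2)
    = (\<Prod>l = 0..m. fact l ^ 4 / 16 ^ l * (d\<^sup>2 - (2 * of_nat l + 1)\<^sup>2) ^ (2 * (m - l) + 1))"
proof (induction m)
  case 0
  show ?case
    by (simp add: w_def numeral_2_eq_2 field_simps power2_eq_square)
next
  case (Suc m)
  let ?L = "\<lambda>m. (\<Prod>i<2 * m + 2. w ((i + 1) div 2) * (fact (i div 2))\<^sup>2)
      * (\<Prod>i<2 * m + 2. if even i then 2 else - 2 :: 'a)"
  let ?t = "\<lambda>l. d\<^sup>2 - (2 * of_nat l + 1)\<^sup>2"
  let ?R = "\<lambda>m. \<Prod>l = 0..m. fact l ^ 4 / 16 ^ l * ?t l ^ (2 * (m - l) + 1)"
  let ?m = "Suc m"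
  \<comment> \<open>The two new indices carry \<open>w ?m\<close> and \<open>w (Suc ?m)\<close>;
    reducing the latter gives a square and the new linear factor \<open>?t ?m\<close>.\<close>
  have step: "- 4 * w (Suc ?m) = w ?m * ?t ?m"
  proof -
    have "?t ?m = - 4 * ((1/2 + d/2 + of_nat ?m) * (1/2 - d/2 + of_nat ?m))"
      by (simp add: field_simps power2_eq_square)
    then show ?thesis
      unfolding w_def pochhammer_Suc[of _ ?m] by (simp only: mult_ac)
  qed
  have "?L ?m = ?L m * (- 4) * (w ?m * (fact ?m)\<^sup>2) * (w (Suc ?m) * (fact ?m)\<^sup>2)"
    by (simp add: mult_ac del: fact_Suc)
  also have "\<dots> = ?L m * (w ?m * (fact ?m)\<^sup>2) * ((- 4 * w (Suc ?m)) * (fact ?m)\<^sup>2)"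
    by (simp only: mult_ac)
  also have "\<dots> = ?R m * (w ?m)\<^sup>2 * fact ?m ^ 4 * ?t ?m"
    unfolding Suc.IH step by (simp only: power2_eq_square power4_eq_xxxx mult_ac)
  \<comment> \<open>Each factor of \<open>w\<close> is -1/4 times a factor \<open>?t l\<close>;
    squaring produces the powers of 16.\<close>
  also have "(w ?m)\<^sup>2 = (\<Prod>l = 0..m. ?t l)\<^sup>2 / 16 ^ ?m"
  proof -
    have "((- 4) ^ ?m)\<^sup>2 = (16 :: 'a) ^ ?m"
      by (simp only: power_mult[symmetric] mult.commute[of ?m 2]) (simp only: power_mult, simp)
    then show ?thesis
      unfolding prod_pochhammer_odd' w_def power_mult_distrib[of "(- 4) ^ ?m"] by simp
  qed
  also have "?R m * ((\<Prod>l = 0..m. ?t l)\<^sup>2 / 16 ^ ?m) * fact ?m ^ 4 * ?t ?m = ?R ?m"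
    unfolding prod_power_Suc' by (simp add: mult_ac del: fact_Suc)
  finally show ?case .
qed

text \<open>Both indices of a new block give the same factor, so each step contributes exactly the
  square in \<open>prod_power_Suc\<close>.\<close>

lemma prod_minus:
  fixes d :: "'a :: field_char_0"
  defines "w \<equiv> \<lambda>n. pochhammer (1 + d/2) n * pochhammer (1 - d/2) n"
  shows "(\<Prod>i<2 * m + 2. w (i div 2) * (fact (i div 2))\<^sup>2)
    = (\<Prod>l = 1..m. ((of_nat l)\<^sup>2 / 4 * (d\<^sup>2 - (2 * of_nat l)\<^sup>2)) ^ (2 * (m + 1 - l)))"
proof (induction m)
  case 0
  show ?case
    by (simp add: w_def numeral_2_eq_2)
next
  case (Suc m)
  let ?L = "\<lambda>m. \<Prod>i<2 * m + 2. w (i div 2) * (fact (i div 2))\<^sup>2"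
  let ?P = "\<lambda>m. \<Prod>l = 1..m. ((of_nat l)\<^sup>2 / 4 * (d\<^sup>2 - (2 * of_nat l)\<^sup>2)) ^ (2 * (m + 1 - l))"
  have "?L (Suc m) = ?L m * ((fact (Suc m))\<^sup>2 * w (Suc m))\<^sup>2"
    by (simp add: power2_eq_square mult_ac del: fact_Suc)
  also have "\<dots> = ?P (Suc m)"
    unfolding Suc.IH
    by (simp only: prod_power_Suc prod_pochhammer_even w_def mult.assoc minus_one_power_mult_square)
  finally show ?case .
qed

theorem theorem4p3:
  fixes q r s :: int
    and x d :: "'a :: field_char_0"
    and e_minus e_plus :: "nat \<Rightarrow> 'a"
    and m :: nat
  assumes "q \<ge> 1" and "0 \<le> r" and "r < s"
    and "\<And>k. e_minus k =
           euler_poly k ((x + of_int r) / of_int q) - euler_poly k ((x + of_int s) / of_int q)"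
    and "\<And>k. e_plus k =
           euler_poly k ((x + of_int r) / of_int q) + euler_poly k ((x + of_int s) / of_int q)"
    and "d = (of_int s - of_int r) / of_int q"
  shows "hankel_det e_minus (2 * m) = 0
    \<and> hankel_det e_minus (2 * m + 1) =
        (- 1) ^ (m + 1) * d ^ (2 * m + 2) *
        (\<Prod>l = 1..m. ((of_nat l)\<^sup>2 / 4 * (d\<^sup>2 - (2 * of_nat l)\<^sup>2)) ^ (2 * (m + 1 - l)))
    \<and> hankel_det e_plus (2 * m) =
        (- 1) ^ m * (2 ^ (2 * m + 1) / (fact m)\<^sup>2) *
        (\<Prod>l = 1..m. ((of_nat l)\<^sup>2 / 4 * (d\<^sup>2 - (2 * of_nat l - 1)\<^sup>2)) ^ (2 * (m + 1 - l)))
    \<and> hankel_det e_plus (2 * m + 1) =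
        (\<Prod>l = 0..m. fact l ^ 4 / 16 ^ l *
           (d\<^sup>2 - (2 * of_nat l + 1)\<^sup>2) ^ (2 * (m - l) + 1))"
proof -
  define A where "A = (x + of_int r) / of_int q"
  define B where "B = (x + of_int s) / of_int q"
  define h where "h = (A + B - 1) / 2"
  have d: "B - A = d"
    by (simp add: A_def B_def assms(6) diff_divide_distrib[symmetric])
  have e_minus: "e_minus = (\<lambda>k. euler_poly k A + (- 1) * euler_poly k B)"
    and e_plus: "e_plus = (\<lambda>k. euler_poly k A + 1 * euler_poly k B)"
    using assms(4,5) by (auto simp: A_def B_def)
  interpret minus: symmetric_functional e_minus h "d / 2"
    unfolding e_minus h_def d[symmetric] by (rule symmetric_functional_euler)
  interpret plus: symmetric_functional e_plus h "d / 2"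
    unfolding e_plus h_def d[symmetric] by (rule symmetric_functional_euler)
  \<comment> \<open>The first two moments are 0 and A - B for the difference, 2 and A + B - 1 = 2h
    for the sum. The centre \<open>h\<close> is thus what makes \<open>plus.M [:0, 1:]\<close>
    vanish.\<close>
  have M_minus: "minus.M 1 = 0" "minus.M [:0, 1:] = - d"
    unfolding minus.M_1 minus.M_X by (simp_all only: e_minus euler_poly_0 euler_poly_1 d[symmetric]) simp_all
  have M_plus: "plus.M 1 = 2" "plus.M [:0, 1:] = 0"
    unfolding plus.M_1 plus.M_X by (simp_all only: e_plus euler_poly_0 euler_poly_1 h_def) simp_all
  have ab_minus: "minus.a + 1/2 = 1 + d/2" "minus.b + 1/2 = 1 - d/2"
    by (simp_all add: minus.a_def minus.b_def)
  have odd_size: "2 * m + 1 + 1 = 2 * m + 2" "2 * m + 2 = 2 * Suc m"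
    by simp_all
  have "hankel_det e_minus (2 * m) = 0"
    unfolding minus.hankel_det_odd[OF M_minus(1)] det_swap_blocks_odd by simp
  moreover have "hankel_det e_minus (2 * m + 1) = (- 1) ^ (m + 1) * d ^ (2 * m + 2) *
      (\<Prod>l = 1..m. ((of_nat l)\<^sup>2 / 4 * (d\<^sup>2 - (2 * of_nat l)\<^sup>2)) ^ (2 * (m + 1 - l)))"
  proof -
    \<comment> \<open>The determinant of the m + 1 antidiagonal blocks with entries -d.\<close>
    have "(- (- d)\<^sup>2) ^ Suc m = (- 1) ^ (m + 1) * d ^ (2 * m + 2)"
      by (simp only: power2_minus power_minus[of "d\<^sup>2"] power_mult[symmetric]) simp
    then show ?thesis
      unfolding minus.hankel_det_odd[OF M_minus(1)] M_minus(2) ab_minus odd_size(1) prod_minus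
      unfolding odd_size(2) det_swap_blocks_even by simp
  qed
  moreover have "hankel_det e_plus (2 * m) = (- 1) ^ m * (2 ^ (2 * m + 1) / (fact m)\<^sup>2) *
      (\<Prod>l = 1..m. ((of_nat l)\<^sup>2 / 4 * (d\<^sup>2 - (2 * of_nat l - 1)\<^sup>2)) ^ (2 * (m + 1 - l)))"
    unfolding plus.hankel_det_even[OF M_plus(2)] M_plus(1) plus.a_def plus.b_def
    by (rule prod_plus_even)
  moreover have "hankel_det e_plus (2 * m + 1) = (\<Prod>l = 0..m. fact l ^ 4 / 16 ^ l *
      (d\<^sup>2 - (2 * of_nat l + 1)\<^sup>2) ^ (2 * (m - l) + 1))"
    unfolding plus.hankel_det_even[OF M_plus(2)] M_plus(1) plus.a_def plus.b_def odd_size(1)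
    by (rule prod_plus_odd)
  ultimately show ?thesis
    by blast
qed

end
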